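(* Let $\tilde N:\mathbb{C}\to\mathbb{C}$ satisfy $\tilde N(0)=0$ and $|\tilde N(z_1)-\tilde N(z_2)|\le C_0(\max(|z_1|,|z_2|))\,|z_1-z_2|$ for all $z_1,z_2\in\mathbb{C}$, where $C_0:[0,\infty)\to[0,\infty)$ is increasing. Let $\{L_\alpha\}_{\alpha>0}$ and $L$ be bounded self-adjoint operators on $l^2(\mathbb{Z})$ with $L_\alpha\to L$ in operator norm as $\alpha\to\infty$. Let $u^{(\alpha)},v\in C^1_{loc}(\mathbb{R};l^2(\mathbb{Z}))$ be the well-posed (global) solutions of $$i\dot u^{(\alpha)}_n=(L_\alpha u^{(\alpha)})_n+\tilde N(u^{(\alpha)}_n),\quad u^{(\alpha)}(0)=f^{(\alpha)},\qquad i\dot v_n=(Lv)_n+\tilde N(v_n),\quad v(0)=g,$$ with $f^{(\alpha)},g\in l^2(\mathbb{Z})$. Assume $\sup_{\alpha>0}\|f^{(\alpha)}\|_{l^2}\le M$. Then there exists $C=C(M,\|g\|_{l^2})>0$ such that for all $t\ge0$, $$\|u^{(\alpha)}(t)-v(t)\|_{l^2}\le e^{Ct}\Big(\|f^{(\alpha)}-g\|_{l^2}+t\,\|L_\alpha-L\|\,\|g\|_{l^2}\Big).$$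
   Context: $\|L_\alpha-L\|$ is the operator norm on $l^2(\mathbb{Z})$ (complex-valued square-summable sequences). Under the stated hypotheses on the operators and on $\tilde N$, the initial value problems are asserted to be globally well-posed in $l^2(\mathbb{Z})$: for every initial datum in $l^2(\mathbb{Z})$ there is a unique solution in $C^1_{loc}(\mathbb{R};l^2(\mathbb{Z}))$, and the data-to-solution map is Lipschitz continuous.
   Formalization: Added hypothesis: for each R, C_0(‖w(t)‖) is bounded for all t≥0, uniformly over solutions w for L or any L_α with ‖w(0)‖≤R. Without it the claim is false: L=L_α=0, Ñ(z)=iz ln(1+|z|), f=0 gives doubly exponential growth of v. *)

theory Defs
  imports "HOL-Analysis.Analysis"
begin

section \<open>The Hilbert space of square-summable two-sided complex sequences\<close>

typedef ell2 = "{x :: int \<Rightarrow> complex. (\<lambda>n. (cmod (x n))\<^sup>2) summable_on UNIV}"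
  morphisms coord Abs_ell2
  by (rule exI[of _ "\<lambda>_. 0"]) simp

lemma coord_square_summable: "(\<lambda>n. (cmod (coord x n))\<^sup>2) summable_on UNIV"
  using coord[of x] by simp

lemma ell2_eqI: "(\<And>n. coord x n = coord y n) \<Longrightarrow> x = y"
  by (metis coord_inject ext)

lemma square_summable_add:
  fixes x y :: "int \<Rightarrow> complex"
  assumes "(\<lambda>n. (cmod (x n))\<^sup>2) summable_on UNIV" "(\<lambda>n. (cmod (y n))\<^sup>2) summable_on UNIV"
  shows "(\<lambda>n. (cmod (x n + y n))\<^sup>2) summable_on UNIV"
proof (rule summable_on_comparison_test)
  show "(\<lambda>n. 2 * (cmod (x n))\<^sup>2 + 2 * (cmod (y n))\<^sup>2) summable_on UNIV"
    by (intro summable_on_add summable_on_cmult_right assms)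
  fix n
  have "(cmod (x n + y n))\<^sup>2 \<le> (cmod (x n) + cmod (y n))\<^sup>2"
    by (simp add: norm_triangle_ineq power_mono)
  also have "\<dots> \<le> 2 * (cmod (x n))\<^sup>2 + 2 * (cmod (y n))\<^sup>2"
    using zero_le_power2[of "cmod (x n) - cmod (y n)"] by (simp add: power2_eq_square algebra_simps)
  finally show "(cmod (x n + y n))\<^sup>2 \<le> 2 * (cmod (x n))\<^sup>2 + 2 * (cmod (y n))\<^sup>2" .
qed simp

lemma square_summable_scale:
  fixes x :: "int \<Rightarrow> complex"
  assumes "(\<lambda>n. (cmod (x n))\<^sup>2) summable_on UNIV"
  shows "(\<lambda>n. (cmod (c * x n))\<^sup>2) summable_on UNIV"
  using summable_on_cmult_right[OF assms, of "(cmod c)\<^sup>2"]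
  by (simp add: norm_mult power_mult_distrib)

lemma cinner_summable: "(\<lambda>n. coord x n * cnj (coord y n)) summable_on UNIV"
proof (rule abs_summable_summable, rule summable_on_comparison_test)
  show "(\<lambda>n. (cmod (coord x n))\<^sup>2 + (cmod (coord y n))\<^sup>2) summable_on UNIV"
    by (intro summable_on_add coord_square_summable)
  fix n
  have "2 * (cmod (coord x n) * cmod (coord y n)) \<le> (cmod (coord x n))\<^sup>2 + (cmod (coord y n))\<^sup>2"
    using sum_squares_bound[of "cmod (coord x n)" "cmod (coord y n)"] by simp
  then show "norm (coord x n * cnj (coord y n)) \<le> (cmod (coord x n))\<^sup>2 + (cmod (coord y n))\<^sup>2"
    using mult_nonneg_nonneg[OF norm_ge_zero norm_ge_zero, of "coord x n" "coord y n"]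
    unfolding norm_mult complex_mod_cnj by linarith
qed simp

text \<open>Linear in the first argument, conjugate-linear in the second.\<close>

definition cinner :: "ell2 \<Rightarrow> ell2 \<Rightarrow> complex" where
  "cinner x y = (\<Sum>\<^sub>\<infinity>n. coord x n * cnj (coord y n))"

definition scaleC_ell2 :: "complex \<Rightarrow> ell2 \<Rightarrow> ell2" where
  "scaleC_ell2 c x = Abs_ell2 (\<lambda>n. c * coord x n)"

lemma coord_scaleC: "coord (scaleC_ell2 c x) n = c * coord x n"
  by (simp add: scaleC_ell2_def Abs_ell2_inverse square_summable_scale coord_square_summable)

instantiation ell2 :: real_vector
begin
definition "0 = Abs_ell2 (\<lambda>_. 0)"
definition "x + y = Abs_ell2 (\<lambda>n. coord x n + coord y n)"
definition "- x = scaleC_ell2 (-1) x"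
definition "x - y = x + scaleC_ell2 (-1) y"
definition "scaleR r x = scaleC_ell2 (complex_of_real r) x"

lemma coord_zero: "coord 0 n = 0"
  by (simp add: zero_ell2_def Abs_ell2_inverse)
lemma coord_add: "coord (x + y) n = coord x n + coord y n"
  by (simp add: plus_ell2_def Abs_ell2_inverse square_summable_add coord_square_summable)
lemma coord_minus: "coord (- x) n = - coord x n"
  by (simp add: uminus_ell2_def coord_scaleC)
lemma coord_diff: "coord (x - y) n = coord x n - coord y n"
  by (simp add: minus_ell2_def coord_scaleC coord_add)
lemma coord_scaleR: "coord (r *\<^sub>R x) n = complex_of_real r * coord x n"
  by (simp add: scaleR_ell2_def coord_scaleC)

instance
  by standard
    (auto intro!: ell2_eqI simp: coord_zero coord_add coord_minus coord_diff coord_scaleR algebra_simps)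
end

lemma cinner_add_left: "cinner (x + y) z = cinner x z + cinner y z"
  unfolding cinner_def coord_add distrib_right
  by (rule infsum_add) (rule cinner_summable)+

lemma cinner_scaleR_left: "cinner (r *\<^sub>R x) y = complex_of_real r * cinner x y"
  unfolding cinner_def coord_scaleR mult.assoc
  by (rule infsum_cmult_right) (simp add: cinner_summable)

lemma cinner_commute: "cinner x y = cnj (cinner y x)"
  unfolding cinner_def infsum_cnj[symmetric] by (simp add: mult.commute)

lemma cinner_self: "cinner x x = complex_of_real (\<Sum>\<^sub>\<infinity>n. (cmod (coord x n))\<^sup>2)"
proof -
  have "((\<lambda>n. complex_of_real ((cmod (coord x n))\<^sup>2)) has_sum
      complex_of_real (\<Sum>\<^sub>\<infinity>n. (cmod (coord x n))\<^sup>2)) UNIV"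
    by (intro has_sum_of_real has_sum_infsum coord_square_summable)
  then show ?thesis
    unfolding cinner_def complex_norm_square by (rule infsumI)
qed

instantiation ell2 :: real_inner
begin
definition "inner x y = Re (cinner x y)"
definition "norm x = sqrt (\<Sum>\<^sub>\<infinity>n. (cmod (coord x n))\<^sup>2)"
definition "sgn x = x /\<^sub>R norm x" for x :: ell2
definition "dist x y = norm (x - y)" for x y :: ell2
definition [code del]: "(uniformity :: (ell2 \<times> ell2) filter) = (INF e\<in>{0<..}. principal {(x, y). dist x y < e})"
definition [code del]: "open U \<longleftrightarrow> (\<forall>x\<in>U. eventually (\<lambda>(x', y). x' = x \<longrightarrow> y \<in> U) uniformity)" for U :: "ell2 set"

instance
proof
  fix x y z :: ell2 and r :: real
  show "inner x y = inner y x"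
    unfolding inner_ell2_def by (metis cinner_commute complex_cnj(1) complex.sel(1) cnj.sel(1))
  show "inner (x + y) z = inner x z + inner y z"
    by (simp add: inner_ell2_def cinner_add_left)
  show "inner (r *\<^sub>R x) y = r * inner x y"
    by (simp add: inner_ell2_def cinner_scaleR_left)
  show "0 \<le> inner x x"
    by (simp add: inner_ell2_def cinner_self infsum_nonneg)
  show "inner x x = 0 \<longleftrightarrow> x = 0"
  proof
    assume "inner x x = 0"
    then have "(\<Sum>\<^sub>\<infinity>n. (cmod (coord x n))\<^sup>2) = 0"
      by (simp add: inner_ell2_def cinner_self)
    then have "(cmod (coord x n))\<^sup>2 = 0" for n
      by (intro nonneg_infsum_le_0D[of "\<lambda>n. (cmod (coord x n))\<^sup>2" UNIV])
        (auto simp: coord_square_summable)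
    then show "x = 0" by (intro ell2_eqI) (simp add: coord_zero)
  qed (simp add: inner_ell2_def cinner_self coord_zero)
  show "norm x = sqrt (inner x x)"
    by (simp add: norm_ell2_def inner_ell2_def cinner_self)
qed (simp_all add: sgn_ell2_def dist_ell2_def uniformity_ell2_def open_ell2_def)
end

section \<open>Operators and the evolution equation\<close>

text \<open>
  The library's \<open>bounded_linear\<close> is real-linear, so complex homogeneity is added. The operator
  norm is the library's \<open>onorm\<close>.
\<close>

definition bounded_self_adjoint :: "(ell2 \<Rightarrow> ell2) \<Rightarrow> bool" where
  "bounded_self_adjoint A \<longleftrightarrow>
     bounded_linear A \<and>
     (\<forall>c x. A (scaleC_ell2 c x) = scaleC_ell2 c (A x)) \<and>
     (\<forall>x y. cinner (A x) y = cinner x (A y))"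

text \<open>\<open>w\<close> belongs to \<open>C\<^sup>1(\<real>; \<ell>\<^sup>2)\<close>, with the derivative \<open>w'\<close> taken in the norm of
  \<open>\<ell>\<^sup>2\<close>, and solves \<open>i w' = A w + N(w)\<close>, with \<open>N\<close> acting sitewise.\<close>

definition solves :: "(ell2 \<Rightarrow> ell2) \<Rightarrow> (complex \<Rightarrow> complex) \<Rightarrow> (real \<Rightarrow> ell2) \<Rightarrow> bool" where
  "solves A N w \<longleftrightarrow>
     (\<exists>w'. continuous_on UNIV w' \<and>
        (\<forall>t. (w has_vector_derivative w' t) (at t)) \<and>
        (\<forall>t n. \<i> * coord (w' t) n = coord (A (w t)) n + N (coord (w t) n)))"

text \<open>
  An a priori bound, the quantitative part of global well-posedness: along forward solutions emanating from a ball of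
  initial data, the local Lipschitz constant \<open>C0\<close> of the nonlinearity stays bounded, by a bound
  depending on the radius only, for all operators of the family \<open>\<A>\<close>. For monotone \<open>C0\<close> it
  holds if the \<open>\<ell>\<^sup>2\<close> norm is conserved or nonincreasing in time (for instance if \<open>cnj z * N z\<close>
  is always real), and also if \<open>C0\<close> is bounded. It does not follow from the existence of global
  solutions: for \<open>A = 0\<close> and \<open>N z = \<i> * z * ln (1 + cmod z)\<close> all solutions are global, but
  nonzero ones grow doubly exponentially.
\<close>

definition lipschitz_controlled ::
  "(ell2 \<Rightarrow> ell2) set \<Rightarrow> (complex \<Rightarrow> complex) \<Rightarrow> (real \<Rightarrow> real) \<Rightarrow> bool" where
  "lipschitz_controlled \<A> N C0 \<longleftrightarrow>
     (\<forall>R. \<exists>K. \<forall>A\<in>\<A>. \<forall>w. solves A N w \<and> norm (w 0) \<le> R \<longrightarrow> (\<forall>t\<ge>0. C0 (norm (w t)) \<le> K))"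

end

theory Submission
  imports Defs
begin

text \<open>
  For two solutions the difference \<open>w = u - v\<close> satisfies
  \<open>i w' = A w + (A - B) v + (N(u) - N(v))\<close>. Self-adjointness makes \<open>A w\<close> drop out of the
  derivative of \<open>\<parallel>w\<parallel>\<^sup>2\<close>, so with \<open>K\<close> a bound for the Lipschitz constant along both
  solutions the growth rate of \<open>\<parallel>w\<parallel>\<close> is at most \<open>K \<parallel>w\<parallel> + \<parallel>A - B\<parallel> \<parallel>v\<parallel>\<close>. Comparison with the
  zero solution gives \<open>\<parallel>v(t)\<parallel> \<le> exp (K t) \<parallel>g\<parallel>\<close>, and Gronwall's argument concludes.
\<close>

lemma norm_ell2_power2: "(norm x)\<^sup>2 = (\<Sum>\<^sub>\<infinity>n. (cmod (coord x n))\<^sup>2)"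
  by (simp add: norm_ell2_def infsum_nonneg)

lemma cmod_coord_le_norm: "cmod (coord x n) \<le> norm x"
proof (rule power2_le_imp_le)
  have "(\<Sum>\<^sub>\<infinity>k\<in>{n}. (cmod (coord x k))\<^sup>2) \<le> (\<Sum>\<^sub>\<infinity>k. (cmod (coord x k))\<^sup>2)"
    by (rule infsum_mono2) (auto simp: coord_square_summable)
  then show "(cmod (coord x n))\<^sup>2 \<le> (norm x)\<^sup>2"
    by (simp add: norm_ell2_power2)
qed simp

text \<open>Square and sum over the sites. This is what turns the sitewise Lipschitz estimate for
  \<open>N\<close> into an estimate in the norm.\<close>

lemma norm_ell2_le:
  assumes "\<And>n. cmod (coord x n) \<le> k * cmod (coord y n)" and "0 \<le> k"
  shows "norm x \<le> k * norm y"
proof (rule power2_le_imp_le)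
  have "(\<Sum>\<^sub>\<infinity>n. (cmod (coord x n))\<^sup>2) \<le> (\<Sum>\<^sub>\<infinity>n. k\<^sup>2 * (cmod (coord y n))\<^sup>2)"
  proof (rule infsum_mono)
    show "(cmod (coord x n))\<^sup>2 \<le> k\<^sup>2 * (cmod (coord y n))\<^sup>2" for n
      using power_mono[OF assms(1)[of n], of 2] by (simp add: power_mult_distrib)
  qed (intro summable_on_cmult_right coord_square_summable)+
  also have "\<dots> = k\<^sup>2 * (\<Sum>\<^sub>\<infinity>n. (cmod (coord y n))\<^sup>2)"
    by (rule infsum_cmult_right) (rule coord_square_summable)
  finally show "(norm x)\<^sup>2 \<le> (k * norm y)\<^sup>2"
    by (simp add: norm_ell2_power2 power_mult_distrib)
qed (simp add: assms(2))

lemma norm_scaleC: "norm (scaleC_ell2 c x) = cmod c * norm x"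
proof -
  have "(norm (scaleC_ell2 c x))\<^sup>2 = (cmod c * norm x)\<^sup>2"
    by (simp add: norm_ell2_power2 coord_scaleC norm_mult power_mult_distrib
        infsum_cmult_right coord_square_summable)
  then show ?thesis by simp
qed

lemma cinner_scaleC_left: "cinner (scaleC_ell2 c x) y = c * cinner x y"
  unfolding cinner_def coord_scaleC mult.assoc
  by (rule infsum_cmult_right) (simp add: cinner_summable)

text \<open>Self-adjointness makes \<open>cinner (A x) x\<close> equal to its own conjugate, hence
  real; the factor \<open>- \<i>\<close> makes it purely imaginary, and \<open>inner\<close> is the
  real part.\<close>

lemma inner_self_adjoint_eq_0:
  assumes "bounded_self_adjoint A"
  shows "inner x (scaleC_ell2 (- \<i>) (A x)) = 0"
proof -
  have "cinner (A x) x = cnj (cinner (A x) x)"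
    using assms cinner_commute[of "A x" x] by (simp add: bounded_self_adjoint_def)
  then have "Im (cinner (A x) x) = 0"
    by (metis add_0_iff cnj.sel(2) equation_minus_iff neg_equal_zero)
  then show ?thesis
    by (subst inner_commute) (simp add: inner_ell2_def cinner_scaleC_left)
qed

text \<open>The forcing grows at the same rate \<open>k\<close> as the homogeneous solution.
  Dividing by \<open>exp (k * t)\<close> leaves a constant forcing \<open>b\<close>, whence the term
  \<open>t * b\<close> under the exponential.\<close>

lemma norm_gronwall:
  fixes w w' :: "real \<Rightarrow> 'a::real_inner"
  assumes deriv: "\<And>t. (w has_vector_derivative w' t) (at t)"
    and growth: "\<And>t. 0 \<le> t \<Longrightarrow>
      inner (w t) (w' t) \<le> k * (norm (w t))\<^sup>2 + b * exp (k * t) * norm (w t)"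
    and b: "0 \<le> b" and t: "0 \<le> t"
  shows "norm (w t) \<le> exp (k * t) * (norm (w 0) + t * b)"
proof -
  \<comment> \<open>Integrating factor: for \<open>z\<close> the term with \<open>k\<close> cancels,
    and the growth hypothesis becomes
    \<open>inner (z s) (z' s) \<le> b * norm (z s)\<close>.\<close>
  define z where "z s = exp (- (k * s)) *\<^sub>R w s" for s
  define z' where "z' s = exp (- (k * s)) *\<^sub>R (w' s - k *\<^sub>R w s)" for s
  have z_deriv: "(z has_vector_derivative z' s) (at s)" for s
  proof -
    have "((\<lambda>s. exp (- (k * s))) has_real_derivative - (k * exp (- (k * s)))) (at s)"
      by (auto intro!: derivative_eq_intros)
    from has_vector_derivative_scaleR[OF this deriv] show ?thesis
      unfolding z_def z'_def by (simp add: scaleR_diff_right mult.commute)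
  qed
  have z_growth: "inner (z s) (z' s) \<le> b * norm (z s)" if "0 \<le> s" for s
  proof -
    have "inner (z s) (z' s) = (exp (- (k * s)))\<^sup>2 * (inner (w s) (w' s) - k * (norm (w s))\<^sup>2)"
      unfolding z_def z'_def power2_norm_eq_inner
      by (simp add: inner_diff_right power2_eq_square right_diff_distrib flip: power2_norm_eq_inner)
    also have "\<dots> \<le> (exp (- (k * s)))\<^sup>2 * (b * exp (k * s) * norm (w s))"
      using growth[OF that] by (intro mult_left_mono) auto
    also have "\<dots> = b * norm (z s)"
      by (simp add: z_def power2_eq_square exp_minus)
    finally show ?thesis .
  qed
  \<comment> \<open>The norm of \<open>z\<close> need not be differentiable at zeros of \<open>z\<close>, hence the regularization by \<open>e\<close>.\<close>
  have bound: "norm (z t) \<le> norm (z 0) + t * b + e" if "0 < e" for e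
  proof -
    define \<phi> where "\<phi> s = sqrt (inner (z s) (z s) + e\<^sup>2)" for s
    have pos: "0 < inner (z s) (z s) + e\<^sup>2" for s
      using that by (simp add: add_nonneg_pos)
    have z_le: "norm (z s) \<le> \<phi> s" for s
      by (simp add: \<phi>_def norm_eq_sqrt_inner)
    \<comment> \<open>The derivative of \<phi> is \<open>inner (z s) (z' s) / \<phi> s\<close>,
      which is at most \<open>b\<close> because \<open>norm (z s) \<le> \<phi> s\<close>.\<close>
    have "\<phi> t - b * t \<le> \<phi> 0 - b * 0"
    proof (rule DERIV_nonpos_imp_nonincreasing[OF t, where f = "\<lambda>s. \<phi> s - b * s"])
      fix s assume "0 \<le> s" "s \<le> t"
      have "((\<lambda>s. inner (z s) (z s)) has_real_derivative 2 * inner (z s) (z' s)) (at s)"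
        unfolding has_field_derivative_def
        by (rule has_derivative_eq_rhs[OF has_derivative_inner[OF
              z_deriv[unfolded has_vector_derivative_def] z_deriv[unfolded has_vector_derivative_def]]])
          (simp add: fun_eq_iff inner_commute[of "z' s"])
      then have "((\<lambda>s. \<phi> s - b * s) has_real_derivative inner (z s) (z' s) / \<phi> s - b) (at s)"
        using pos[of s] unfolding \<phi>_def
        by (auto intro!: derivative_eq_intros simp: field_simps)
      moreover have "inner (z s) (z' s) / \<phi> s \<le> b"
      proof -
        have "inner (z s) (z' s) \<le> b * \<phi> s"
          using z_growth[OF \<open>0 \<le> s\<close>] mult_left_mono[OF z_le b, of s] by linarith
        then show ?thesis
          using pos[of s] by (simp add: \<phi>_def pos_divide_le_eq)
      qed
      ultimately show "\<exists>y. ((\<lambda>s. \<phi> s - b * s) has_real_derivative y) (at s) \<and> y \<le> 0"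
        by (intro exI[of _ "inner (z s) (z' s) / \<phi> s - b"]) simp
    qed
    moreover have "\<phi> 0 \<le> norm (z 0) + e"
      unfolding \<phi>_def power2_norm_eq_inner[symmetric] using that
      by (intro real_le_lsqrt) (auto simp: power2_sum)
    ultimately show ?thesis
      using z_le[of t] by (simp add: mult.commute)
  qed
  have "norm (z t) \<le> norm (z 0) + t * b"
    by (rule field_le_epsilon) (rule bound)
  moreover have "norm (w t) = exp (k * t) * norm (z t)" "z 0 = w 0"
    by (simp_all add: z_def exp_minus)
  ultimately show ?thesis
    by simp
qed

text \<open>The exponential bound on \<open>v\<close> is a hypothesis so that the lemma can serve
  twice: first against the zero solution with \<open>G = 0\<close>, which yields such a bound, and
  then for the two given solutions.\<close>

lemma solves_diff_le:
  assumes N_lipschitz: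
      "\<And>z1 z2. cmod (N z1 - N z2) \<le> C0 (max (cmod z1) (cmod z2)) * cmod (z1 - z2)"
    and C0_nonneg: "\<And>r. 0 \<le> r \<Longrightarrow> 0 \<le> C0 r" and C0_mono: "mono_on {0..} C0"
    and A: "bounded_self_adjoint A" and B: "bounded_self_adjoint B"
    and u: "solves A N u" and v: "solves B N v"
    and Ku: "\<And>t. 0 \<le> t \<Longrightarrow> C0 (norm (u t)) \<le> K" and Kv: "\<And>t. 0 \<le> t \<Longrightarrow> C0 (norm (v t)) \<le> K"
    and v_le: "\<And>t. 0 \<le> t \<Longrightarrow> norm (v t) \<le> exp (K * t) * G"
    and t: "0 \<le> t"
  shows "norm (u t - v t) \<le>
    exp (K * t) * (norm (u 0 - v 0) + t * (onorm (\<lambda>x. A x - B x) * G))"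
proof -
  obtain u' where u': "\<And>t. (u has_vector_derivative u' t) (at t)"
    "\<And>t n. \<i> * coord (u' t) n = coord (A (u t)) n + N (coord (u t) n)"
    using u unfolding solves_def by blast
  obtain v' where v': "\<And>t. (v has_vector_derivative v' t) (at t)"
    "\<And>t n. \<i> * coord (v' t) n = coord (B (v t)) n + N (coord (v t) n)"
    using v unfolding solves_def by blast
  have lin: "bounded_linear A" "bounded_linear B"
    using A B by (auto simp: bounded_self_adjoint_def)
  have D: "bounded_linear (\<lambda>x. A x - B x)"
    using lin by (rule bounded_linear_sub)
  define \<delta> where "\<delta> = onorm (\<lambda>x. A x - B x)"
  have \<delta>: "0 \<le> \<delta>"
    unfolding \<delta>_def by (rule onorm_pos_le[OF D])
  have K: "0 \<le> K"
    using Ku[of 0] C0_nonneg[of "norm (u 0)"] by simp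
  have G: "0 \<le> G"
    using order_trans[OF norm_ge_zero v_le[of 0]] by simp
  show ?thesis
    unfolding \<delta>_def[symmetric]
  proof (rule norm_gronwall[OF _ _ mult_nonneg_nonneg[OF \<delta> G] t])
    show "((\<lambda>s. u s - v s) has_vector_derivative u' s - v' s) (at s)" for s
      by (intro has_vector_derivative_diff u' v')
    fix s :: real assume s: "0 \<le> s"
    let ?w = "u s - v s"
    \<comment> \<open>\<open>nl\<close> is the sitewise difference \<open>N(u) - N(v)\<close>, an element of the space by the equation.\<close>
    define nl where "nl = scaleC_ell2 \<i> (u' s - v' s) - A ?w - (A (v s) - B (v s))"
    have "coord nl n = N (coord (u s) n) - N (coord (v s) n)" for n
      using u'(2)[of s n] v'(2)[of s n]
      by (simp add: nl_def coord_add coord_diff coord_scaleC linear_diff[OF bounded_linear.linear[OF lin(1)]]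
          right_diff_distrib)
    moreover have "cmod (N (coord (u s) n) - N (coord (v s) n)) \<le> K * cmod (coord ?w n)" for n
    proof -
      \<comment> \<open>Each coordinate is dominated by the norm, so monotonicity moves
        \<open>C0\<close> to the larger of the two norms, where one of \<open>Ku\<close> and
        \<open>Kv\<close> applies.\<close>
      have "C0 (max (cmod (coord (u s) n)) (cmod (coord (v s) n)))
          \<le> C0 (max (norm (u s)) (norm (v s)))"
        by (intro mono_onD[OF C0_mono] max.mono cmod_coord_le_norm) (auto simp: le_max_iff_disj)
      also have "\<dots> \<le> K"
        using Ku[OF s] Kv[OF s] by (simp add: max_def)
      finally show ?thesis
        using order_trans[OF N_lipschitz mult_right_mono] by (simp add: coord_diff)
    qed
    ultimately have nl_le: "norm nl \<le> K * norm ?w"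
      by (intro norm_ell2_le K) simp
    have "norm (A (v s) - B (v s)) \<le> \<delta> * norm (v s)"
      unfolding \<delta>_def by (rule onorm[OF D])
    also have "\<dots> \<le> \<delta> * (exp (K * s) * G)"
      by (intro mult_left_mono v_le s \<delta>)
    finally have D_le: "norm (A (v s) - B (v s)) \<le> \<delta> * G * exp (K * s)"
      by (simp add: mult_ac)
    \<comment> \<open>Here \<open>A u - B v\<close> is split as
      \<open>A (u - v) + (A - B) v\<close>. The first summand is orthogonal to \<open>?w\<close> for
      the real inner product; the other collects the two terms just estimated.\<close>
    have w': "u' s - v' s = scaleC_ell2 (- \<i>) (A ?w) + scaleC_ell2 (- \<i>) (A (v s) - B (v s) + nl)"
      by (rule ell2_eqI)
        (simp add: nl_def coord_add coord_diff coord_scaleC algebra_simps)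
    have "inner ?w (u' s - v' s) = inner ?w (scaleC_ell2 (- \<i>) (A (v s) - B (v s) + nl))"
      unfolding w' by (simp add: inner_add_right inner_self_adjoint_eq_0[OF A])
    also have "\<dots> \<le> norm ?w * norm (scaleC_ell2 (- \<i>) (A (v s) - B (v s) + nl))"
      by (rule norm_cauchy_schwarz)
    also have "\<dots> \<le> norm ?w * (\<delta> * G * exp (K * s) + K * norm ?w)"
      using norm_triangle_ineq[of "A (v s) - B (v s)" nl] D_le nl_le
      by (intro mult_left_mono) (auto simp: norm_scaleC)
    also have "\<dots> = K * (norm ?w)\<^sup>2 + \<delta> * G * exp (K * s) * norm ?w"
      by (simp add: power2_eq_square algebra_simps)
    finally show "inner ?w (u' s - v' s) \<le> \<dots>" .
  qed
qed

lemma solves_zero: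
  assumes "bounded_linear A" and "N 0 = 0"
  shows "solves A N (\<lambda>_. 0)"
  unfolding solves_def using assms
  by (intro exI[of _ "\<lambda>_. 0"])
    (auto simp: coord_zero linear_0[OF bounded_linear.linear])

theorem proposition3p2:
  fixes N :: "complex \<Rightarrow> complex" and C0 :: "real \<Rightarrow> real"
    and La :: "real \<Rightarrow> ell2 \<Rightarrow> ell2" and L :: "ell2 \<Rightarrow> ell2"
  assumes N_zero: "N 0 = 0"
    and N_lipschitz: "\<And>z1 z2. cmod (N z1 - N z2) \<le> C0 (max (cmod z1) (cmod z2)) * cmod (z1 - z2)"
    and C0_nonneg: "\<And>r. 0 \<le> r \<Longrightarrow> 0 \<le> C0 r"
    and C0_mono: "mono_on {0..} C0"
    and La: "\<And>\<alpha>. 0 < \<alpha> \<Longrightarrow> bounded_self_adjoint (La \<alpha>)"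
    and L: "bounded_self_adjoint L"
    and La_tendsto: "((\<lambda>\<alpha>. onorm (\<lambda>x. La \<alpha> x - L x)) \<longlongrightarrow> 0) at_top"
    and controlled: "lipschitz_controlled (insert L (La ` {0<..})) N C0"
  shows "\<exists>C :: real \<Rightarrow> real \<Rightarrow> real. (\<forall>M G. 0 < C M G) \<and>
    (\<forall>M (f :: real \<Rightarrow> ell2) (g :: ell2) (u :: real \<Rightarrow> real \<Rightarrow> ell2) (v :: real \<Rightarrow> ell2).
      (\<forall>\<alpha>>0. norm (f \<alpha>) \<le> M) \<longrightarrow>
      (\<forall>\<alpha>>0. solves (La \<alpha>) N (u \<alpha>) \<and> u \<alpha> 0 = f \<alpha>) \<longrightarrow>
      solves L N v \<and> v 0 = g \<longrightarrow>
      (\<forall>\<alpha>>0. \<forall>t\<ge>0. norm (u \<alpha> t - v t) \<le>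
         exp (C M (norm g) * t) *
         (norm (f \<alpha> - g) + t * onorm (\<lambda>x. La \<alpha> x - L x) * norm g)))"
proof -
  \<comment> \<open>One bound per radius, common to \<open>L\<close> and all
    \<open>La \<alpha>\<close>: this makes the final constant independent of \<alpha> and of the
    particular solutions.\<close>
  obtain \<kappa> where \<kappa>: "\<And>R A w t. A \<in> insert L (La ` {0<..}) \<Longrightarrow> solves A N w \<Longrightarrow> norm (w 0) \<le> R \<Longrightarrow>
      0 \<le> t \<Longrightarrow> C0 (norm (w t)) \<le> \<kappa> R"
    using controlled unfolding lipschitz_controlled_def by metis
  \<comment> \<open>The radius \<open>max M G\<close> covers the data of both equations; the outer
    maximum with 1 ensures positivity.\<close>
  define C where "C M G = max 1 (\<kappa> (max M G))" for M G
  have "norm (u \<alpha> t - v t) \<le> exp (C M (norm g) * t) *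
      (norm (f \<alpha> - g) + t * onorm (\<lambda>x. La \<alpha> x - L x) * norm g)"
    if f: "\<forall>\<alpha>>0. norm (f \<alpha>) \<le> M" and u: "\<forall>\<alpha>>0. solves (La \<alpha>) N (u \<alpha>) \<and> u \<alpha> 0 = f \<alpha>"
      and v: "solves L N v \<and> v 0 = g" and \<alpha>: "0 < \<alpha>" and t: "0 \<le> t"
    for M f g u v \<alpha> t
  proof -
    let ?K = "C M (norm g)"
    have Ku: "C0 (norm (u \<alpha> s)) \<le> ?K" if "0 \<le> s" for s
      unfolding C_def by (rule max.coboundedI2, rule \<kappa>[of "La \<alpha>"])
        (use f u \<alpha> that in \<open>auto simp: le_max_iff_disj\<close>)
    have Kv: "C0 (norm (v s)) \<le> ?K" if "0 \<le> s" for s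
      unfolding C_def by (rule max.coboundedI2, rule \<kappa>[of L])
        (use v that in \<open>auto simp: le_max_iff_disj\<close>)
    \<comment> \<open>The zero solution will be one of the two compared, so \<open>C0\<close> at 0
      has to be bounded by the same constant.\<close>
    have K0: "C0 (norm (0 :: ell2)) \<le> ?K"
      using mono_onD[OF C0_mono, of 0 "norm (v 0)"] Kv[of 0] by simp
    have v_le: "norm (v s) \<le> exp (?K * s) * norm g" if s: "0 \<le> s" for s
    proof -
      have zero: "solves L N (\<lambda>_. 0)"
        using L N_zero by (intro solves_zero) (auto simp: bounded_self_adjoint_def)
      \<comment> \<open>With \<open>L\<close> in both places the operator difference vanishes, and
        with \<open>G = 0\<close> the bound required of the zero solution is trivial.\<close>
      have "norm (v s - 0) \<le> exp (?K * s) * (norm (v 0 - 0) + s * (onorm (\<lambda>x. L x - L x) * 0))"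
        by (rule solves_diff_le[where u = v and v = "\<lambda>_. 0",
              OF N_lipschitz C0_nonneg C0_mono L L conjunct1[OF v] zero Kv K0 _ s])
          simp_all
      then show ?thesis
        using v by simp
    qed
    show ?thesis
      using solves_diff_le[where u = "u \<alpha>" and v = v,
          OF N_lipschitz C0_nonneg C0_mono La[OF \<alpha>] L _ _ Ku Kv v_le t] u v \<alpha>
      by (simp add: mult.assoc)
  qed
  moreover have "0 < C M G" for M G
    by (simp add: C_def)
  ultimately show ?thesis
    by (intro exI[of _ C]) blast
qed

end
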